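(* For every $n\ge5$, $$\max_{S\in\mathcal{G}_n}\#\mathrm{comp}(K_S)\ge2^{n-4}\quad\text{and}\quad\max_{S\in\mathcal{G}_n}h(S)\ge3\cdot2^{n-4}-2n+5.$$
   Context: For a finite integer sequence $S=(s_1,\ldots,s_n)$, its difference triangle is defined by $s_a^0:=s_a$ and $s_a^b:=|s_{a+1}^{b-1}-s_a^{b-1}|$ for $b\ge 1$, $1\le a\le n-b$ (superscripts of $s$ are row indices, not powers). $S$ is Gilbreath if $s_1^b=1$ for every $1\le b\le n-1$. For $n\ge 2$, $\mathcal{G}_n$ is the set of strictly increasing Gilbreath integer sequences $(s_1,\ldots,s_n)$ of length $n$ with $(s_1,s_2)=(2,3)$. The valid-extension set of $S$ is $K_S:=\{k\in\mathbb{Z}:(s_1,\ldots,s_n,k)\text{ is Gilbreath}\}$. The right anti-diagonal of $S$ is $(e_1,\ldots,e_{n-1})$ with $e_i:=s_{n-i}^i$, and $A(S):=\sum_{i=1}^{n-1}e_i$. The candidate set is $C_S:=\{k\in\mathbb{Z}:|k-s_n|\le A(S)+1,\ k\equiv s_n\pmod 2\}$, the hole set is $H_S:=C_S\setminus K_S$, and the defect is $h(S):=|H_S|$. For a finite set $X\subseteq\mathbb{Z}$ all of one parity class, $\#\mathrm{comp}(X)$ is the number of maximal runs of common difference $2$ in $X$ (for $S\in\mathcal{G}_n$ the set $K_S$ is finite with all elements of the same parity as $s_n$). *)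

theory Defs
  imports "HOL-Number_Theory.Cong"
begin

text \<open>
  A finite sequence \<open>(s\<^sub>1, \<dots>, s\<^sub>n)\<close> is a list of length \<open>n\<close>. The entry \<open>triangle S b a\<close> of its
  difference triangle keeps the column index \<open>a\<close> starting at 1; only the arguments with
  \<open>1 \<le> a \<le> length S - b\<close> are meaningful, and the definitions below use no others.
\<close>

fun triangle :: "int list \<Rightarrow> nat \<Rightarrow> nat \<Rightarrow> int" where
  "triangle S 0 a = S ! (a - 1)"
| "triangle S (Suc b) a = \<bar>triangle S b (a + 1) - triangle S b a\<bar>"

definition gilbreath :: "int list \<Rightarrow> bool" where
  "gilbreath S \<longleftrightarrow> (\<forall>b \<in> {1..length S - 1}. triangle S b 1 = 1)"

text \<open>Meaningful for \<open>n \<ge> 2\<close> only.\<close>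

definition gilbreath_seqs :: "nat \<Rightarrow> int list set" where
  "gilbreath_seqs n =
     {S. length S = n \<and> sorted_wrt (<) S \<and> gilbreath S \<and> S ! 0 = 2 \<and> S ! 1 = 3}"

definition extensions :: "int list \<Rightarrow> int set" where
  "extensions S = {k. gilbreath (S @ [k])}"

definition antidiagonal :: "int list \<Rightarrow> nat \<Rightarrow> int" where
  "antidiagonal S i = triangle S i (length S - i)"

definition antidiagonal_sum :: "int list \<Rightarrow> int" where
  "antidiagonal_sum S = (\<Sum>i = 1..length S - 1. antidiagonal S i)"

definition candidates :: "int list \<Rightarrow> int set" where
  "candidates S = {k. \<bar>k - last S\<bar> \<le> antidiagonal_sum S + 1 \<and> [k = last S] (mod 2)}"

definition holes :: "int list \<Rightarrow> int set" where
  "holes S = candidates S - extensions S"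

definition defect :: "int list \<Rightarrow> nat" where
  "defect S = card (holes S)"

text \<open>The runs \<open>{a, a + 2, \<dots>, a + 2m}\<close> contained in \<open>X\<close>, and the number of inclusion-maximal ones.\<close>

definition runs :: "int set \<Rightarrow> int set set" where
  "runs X = {R. R \<subseteq> X \<and> (\<exists>a m. R = (\<lambda>j::nat. a + 2 * int j) ` {0..m})}"

definition num_components :: "int set \<Rightarrow> nat" where
  "num_components X = card {R \<in> runs X. \<forall>R' \<in> runs X. R \<subseteq> R' \<longrightarrow> R' = R}"

text \<open>
  The maxima over \<open>gilbreath_seqs n\<close> range over a finite set, and the cardinalities above are
  cardinalities of finite sets.
\<close>

lemma triangle_append:
  "\<lbrakk>1 \<le> a; a + b \<le> length S\<rbrakk> \<Longrightarrow> triangle (S @ [k]) b a = triangle S b a"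
  by (induction b arbitrary: a) (auto simp: nth_append)

lemma finite_extensions:
  assumes "S \<noteq> []"
  shows "finite (extensions S)"
proof -
  let ?n = "length S"
  define e where "e b = \<bar>triangle S b (?n - b)\<bar>" for b
  have bound: "\<bar>k\<bar> \<le> 1 + (\<Sum>b<?n. e b)" if "gilbreath (S @ [k])" for k
  proof -
    define d where "d b = triangle (S @ [k]) b (Suc ?n - b)" for b
    have step: "\<bar>d b\<bar> \<le> \<bar>d (Suc b)\<bar> + e b" if "b < ?n" for b
    proof -
      have "triangle (S @ [k]) b (?n - b) = triangle S b (?n - b)"
        using that by (intro triangle_append) auto
      moreover have "?n - b + 1 = Suc ?n - b"
        using that by simp
      ultimately have "d (Suc b) = \<bar>d b - triangle S b (?n - b)\<bar>"
        unfolding d_def by simp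
      then show ?thesis
        by (simp add: e_def)
    qed
    have "\<bar>d 0\<bar> \<le> \<bar>d m\<bar> + (\<Sum>b<m. e b)" if "m \<le> ?n" for m
      using that
    proof (induction m)
      case (Suc m)
      then show ?case using step[of m] by simp
    qed simp
    from this[of ?n] have "\<bar>d 0\<bar> \<le> \<bar>d ?n\<bar> + (\<Sum>b<?n. e b)"
      by simp
    moreover have "d ?n = 1"
      using \<open>gilbreath (S @ [k])\<close> assms unfolding gilbreath_def d_def
      by (simp add: Suc_le_eq)
    moreover have "d 0 = k"
      by (simp add: d_def)
    ultimately show ?thesis by simp
  qed
  have "extensions S \<subseteq> {- (1 + (\<Sum>b<?n. e b))..1 + (\<Sum>b<?n. e b)}"
    using bound by (force simp: extensions_def)
  then show ?thesis
    by (rule finite_subset) simp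
qed

lemma finite_gilbreath_seqs:
  assumes "2 \<le> n"
  shows "finite (gilbreath_seqs n)"
  using assms
proof (induction n rule: dec_induct)
  case base
  have "gilbreath_seqs 2 \<subseteq> {[2, 3]}"
    by (auto simp: gilbreath_seqs_def length_Suc_conv numeral_2_eq_2)
  then show ?case
    by (rule finite_subset) simp
next
  case (step n)
  have "gilbreath_seqs (Suc n) \<subseteq> (\<Union>S \<in> gilbreath_seqs n. (\<lambda>k. S @ [k]) ` extensions S)"
  proof
    fix T assume T: "T \<in> gilbreath_seqs (Suc n)"
    then obtain S k where Sk: "T = S @ [k]" "length S = n"
      by (cases T rule: rev_cases) (auto simp: gilbreath_seqs_def)
    have "triangle S b 1 = 1" if "b \<in> {1..length S - 1}" for b
      using that T Sk triangle_append[of 1 b S k]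
      by (auto simp: gilbreath_seqs_def gilbreath_def)
    then have "S \<in> gilbreath_seqs n"
      using T Sk step by (auto simp: gilbreath_seqs_def gilbreath_def sorted_wrt_append nth_append
          split: if_splits)
    moreover have "k \<in> extensions S"
      using T Sk by (simp add: gilbreath_seqs_def extensions_def)
    ultimately show "T \<in> (\<Union>S \<in> gilbreath_seqs n. (\<lambda>k. S @ [k]) ` extensions S)"
      using Sk by blast
  qed
  moreover have "finite (\<Union>S \<in> gilbreath_seqs n. (\<lambda>k. S @ [k]) ` extensions S)"
  proof (intro finite_UN_I finite_imageI finite_extensions)
    show "S \<noteq> []" if "S \<in> gilbreath_seqs n" for S
      using that step by (auto simp: gilbreath_seqs_def)
  qed (use step in auto)
  ultimately show ?case
    by (rule finite_subset)
qed

lemma finite_holes: "finite (holes S)"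
proof -
  have "holes S \<subseteq> {last S - (antidiagonal_sum S + 1)..last S + (antidiagonal_sum S + 1)}"
    by (auto simp: holes_def candidates_def)
  then show ?thesis
    by (rule finite_subset) simp
qed

lemma finite_runs: "finite X \<Longrightarrow> finite (runs X)"
  by (rule finite_subset[of _ "Pow X"]) (auto simp: runs_def)

end

theory Submission
  imports Defs
begin

text \<open>
  Both bounds are attained by \<open>S = (2, 3, 5, 9, \<dots>, 2 ^ (n - 2) + 1, 2 ^ (n - 1) - 1)\<close>, with right
  anti-diagonal \<open>e\<^sub>i = 2 ^ (n - 1 - i) - 2\<close> for \<open>i \<le> n - 2\<close> and \<open>e\<^sub>n\<^sub>-\<^sub>1 = 1\<close>. Appending \<open>k\<close> to
  \<open>S\<close> creates the anti-diagonal \<open>d\<^sub>0 = k\<close>, \<open>d\<^sub>i\<^sub>+\<^sub>1 = \<bar>d\<^sub>i - e\<^sub>i\<bar>\<close> (with \<open>e\<^sub>0 = s\<^sub>n\<close>), and the extension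
  is Gilbreath iff \<open>d\<^sub>n = 1\<close>. Solving backwards, the last four steps leave the block \<open>{-4, -2, 0, 2, 4}\<close>
  of differences \<open>d\<^sub>n\<^sub>-\<^sub>4 - e\<^sub>n\<^sub>-\<^sub>4\<close>. Every earlier \<open>e\<^sub>i\<close> is so large that the translates by \<open>e\<^sub>i\<close> and \<open>-e\<^sub>i\<close>
  are separated, so each step doubles both the number of blocks and the number of points.
\<close>

section \<open>Counting components by their left ends\<close>

text \<open>Each left end is sent to the longest run in \<open>X\<close> starting there. This map is
  injective because the start is the least element of its run.\<close>

lemma card_left_ends_le_num_components:
  assumes "finite X"
  shows "card {x \<in> X. x - 2 \<notin> X} \<le> num_components X"
proof -
  define run where "run x m = (\<lambda>j. x + 2 * int j) ` {0..m}" for x m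
  define M where "M x = Max {m. run x m \<subseteq> X}" for x
  have run_start: "x \<in> run x m" for x m
    unfolding run_def by (rule image_eqI[of _ _ 0]) auto
  have run_ge: "x \<le> y" if "y \<in> run x m" for x y m
    using that by (auto simp: run_def)
  \<comment> \<open>The endpoint \<open>x + 2 * int m\<close> of such a run lies in the finite set
    \<open>X\<close>, and it determines \<open>m\<close>.\<close>
  have fin: "finite {m. run x m \<subseteq> X}" for x
  proof (rule finite_subset)
    show "{m. run x m \<subseteq> X} \<subseteq> (\<lambda>j. x + 2 * int j) -` X"
      unfolding run_def vimage_def by (intro Collect_mono impI) (erule subsetD, rule imageI, simp)
    show "finite ((\<lambda>j. x + 2 * int j) -` X)"
      using assms by (intro finite_vimageI) (auto simp: inj_on_def)
  qed
  have run_M: "run x (M x) \<subseteq> X" if "x \<in> X" for x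
  proof -
    have "0 \<in> {m. run x m \<subseteq> X}"
      using that by (simp add: run_def)
    then show ?thesis
      using Max_in[OF fin[of x]] unfolding M_def by blast
  qed
  have maximal: "R = run x (M x)"
    if "x - 2 \<notin> X" and R_run: "R \<in> runs X" and R_sup: "run x (M x) \<subseteq> R" for x R
  proof -
    obtain a m where R: "R = run a m" and "R \<subseteq> X"
      using R_run unfolding runs_def run_def by blast
    obtain i where i: "x = a + 2 * int i" "i \<le> m"
      using subsetD[OF R_sup run_start] unfolding R run_def by auto
    \<comment> \<open>A run through \<open>x\<close> that starts further left would contain
      \<open>x - 2\<close>.\<close>
    have "i = 0"
    proof (rule ccontr)
      assume "i \<noteq> 0"
      then have "x - 2 = a + 2 * int (i - 1)" "i - 1 \<in> {0..m}"
        using i by auto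
      then have "x - 2 \<in> R"
        unfolding R run_def by (rule image_eqI)
      then show False
        using \<open>R \<subseteq> X\<close> \<open>x - 2 \<notin> X\<close> by blast
    qed
    then have "R = run x m"
      using R i by simp
    moreover from this have "m \<le> M x"
      unfolding M_def using \<open>R \<subseteq> X\<close> by (intro Max_ge fin) auto
    then have "run x m \<subseteq> run x (M x)"
      by (auto simp: run_def)
    ultimately show ?thesis
      using R_sup by blast
  qed
  have "inj_on (\<lambda>x. run x (M x)) X"
  proof (rule inj_onI)
    fix x y assume "run x (M x) = run y (M y)"
    then show "x = y"
      using run_start[of x "M x"] run_start[of y "M y"] run_ge[of y x "M x"] run_ge[of x y "M y"]
      by simp
  qed
  then have "inj_on (\<lambda>x. run x (M x)) {x \<in> X. x - 2 \<notin> X}"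
    by (rule inj_on_subset) auto
  moreover have "(\<lambda>x. run x (M x)) ` {x \<in> X. x - 2 \<notin> X}
      \<subseteq> {R \<in> runs X. \<forall>R' \<in> runs X. R \<subseteq> R' \<longrightarrow> R' = R}"
  proof (intro image_subsetI CollectI conjI ballI impI)
    fix x assume "x \<in> {x \<in> X. x - 2 \<notin> X}"
    then have x: "x \<in> X" "x - 2 \<notin> X" by auto
    show "run x (M x) \<in> runs X"
      using run_M[OF x(1)] unfolding runs_def run_def by blast
    show "R = run x (M x)" if "R \<in> runs X" "run x (M x) \<subseteq> R" for R
      using maximal x(2) that by blast
  qed
  ultimately show ?thesis
    unfolding num_components_def by (rule card_inj_on_le) (simp add: finite_runs[OF assms])
qed

section \<open>The recursive structure of the valid offsets\<close>

text \<open>The differences \<open>k - s\<^sub>n\<close> for the valid extensions \<open>k\<close>, where \<open>n = j + 4\<close>.\<close>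

fun offsets :: "nat \<Rightarrow> int set" where
  "offsets 0 = {-4, -2, 0, 2, 4}"
| "offsets (Suc j) = (+) (2 ^ (j + 3) - 2) ` offsets j \<union> (+) (2 - 2 ^ (j + 3)) ` offsets j"

lemma offsets_Suc_iff:
  "u \<in> offsets (Suc j) \<longleftrightarrow>
     u - (2 ^ (j + 3) - 2) \<in> offsets j \<or> u + (2 ^ (j + 3) - 2) \<in> offsets j"
proof -
  have "u \<in> (+) c ` offsets j \<longleftrightarrow> u - c \<in> offsets j" for c
    by (force simp: image_iff)
  from this[of "2 ^ (j + 3) - 2"] this[of "2 - 2 ^ (j + 3)"] show ?thesis
    by (simp add: algebra_simps)
qed

lemma finite_offsets [simp]: "finite (offsets j)"
  by (induction j) auto

declare offsets.simps(2) [simp del]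

text \<open>The bound is 2 less than the next shift \<open>2 ^ (j + 3) - 2\<close>. Hence one
  translate lies in the range \<le> -2 and the other in the range \<ge> 2: they are disjoint and no
  run joins them.\<close>

lemma abs_offsets_le: "u \<in> offsets j \<Longrightarrow> \<bar>u\<bar> \<le> 2 ^ (j + 3) - 4"
proof (induction j arbitrary: u)
  case (Suc j)
  then have "\<bar>u - (2 ^ (j + 3) - 2)\<bar> \<le> 2 ^ (j + 3) - 4
    \<or> \<bar>u + (2 ^ (j + 3) - 2)\<bar> \<le> 2 ^ (j + 3) - 4"
    unfolding offsets_Suc_iff by blast
  then show ?case
    unfolding add_Suc power_Suc by linarith
qed auto

text \<open>Negation fixes the base block and swaps the two translates. This symmetry lets \<bar>k -
  s\<bar> stand for k - s, where s is the last term.\<close>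

lemma uminus_offsets: "u \<in> offsets j \<Longrightarrow> - u \<in> offsets j"
proof (induction j arbitrary: u)
  case (Suc j)
  then show ?case
    using Suc.IH[of "u - (2 ^ (j + 3) - 2)"] Suc.IH[of "u + (2 ^ (j + 3) - 2)"]
    by (auto simp: offsets_Suc_iff algebra_simps)
qed auto

lemma abs_offsets_iff [simp]: "\<bar>u\<bar> \<in> offsets j \<longleftrightarrow> u \<in> offsets j"
  using uminus_offsets[of u j] uminus_offsets[of "- u" j] by (auto simp: abs_if)

text \<open>A nonnegative \<open>d\<close> cannot come from the negative translate, since
  \<open>d\<close> plus the shift exceeds the bound on \<open>offsets j\<close>. This inverts one
  step of the new anti-diagonal.\<close>

lemma offsets_Suc_nonneg_iff:
  assumes "d \<ge> 0"
  shows "d \<in> offsets (Suc j) \<longleftrightarrow> d - (2 ^ (j + 3) - 2) \<in> offsets j"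
  using abs_offsets_le[of "d + (2 ^ (j + 3) - 2)" j] assms unfolding offsets_Suc_iff by auto

text \<open>An upper bound on the number of extensions yields the lower bound on the number of
  holes.\<close>

lemma card_offsets_le: "card (offsets j) \<le> 5 * 2 ^ j"
proof (induction j)
  case (Suc j)
  have "card (offsets (Suc j)) \<le> card (offsets j) + card (offsets j)"
    unfolding offsets.simps by (rule order.trans[OF card_Un_le]) (simp add: card_image)
  then show ?case
    using Suc by simp
qed simp

lemma card_left_ends_offsets_ge: "2 ^ j \<le> card {u \<in> offsets j. u - 2 \<notin> offsets j}"
proof (induction j)
  case 0
  have "{u \<in> offsets 0. u - 2 \<notin> offsets 0} = {-4}" by auto
  then show ?case by simp
next
  case (Suc j)
  define c :: int where "c = 2 ^ (j + 3) - 2"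
  define L where "L i = {u \<in> offsets i. u - 2 \<notin> offsets i}" for i
  have off: "u \<in> offsets (Suc j) \<longleftrightarrow> u - c \<in> offsets j \<or> u + c \<in> offsets j" for u
    unfolding c_def by (rule offsets_Suc_iff)
  have bound: "\<bar>u\<bar> \<le> c - 2" if "u \<in> offsets j" for u
    using abs_offsets_le[OF that] by (simp add: c_def)
  \<comment> \<open>A left end stays one after translation: its predecessor is missing from its own
    translate, and the other translate is too far away to supply it.\<close>
  have "(+) c ` L j \<union> (+) (- c) ` L j \<subseteq> L (Suc j)"
  proof (intro Un_least image_subsetI)
    fix u assume "u \<in> L j"
    then have u: "u \<in> offsets j" "u - 2 \<notin> offsets j"
      by (auto simp: L_def)
    show "c + u \<in> L (Suc j)"
      using u bound[OF u(1)] bound[of "c + u - 2 + c"] by (auto simp: L_def off)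
    show "- c + u \<in> L (Suc j)"
      using u bound[OF u(1)] bound[of "- c + u - 2 - c"] by (auto simp: L_def off algebra_simps)
  qed
  then have "card ((+) c ` L j \<union> (+) (- c) ` L j) \<le> card (L (Suc j))"
    by (rule card_mono[rotated]) (simp add: L_def)
  moreover have "(+) c ` L j \<inter> (+) (- c) ` L j = {}"
    by (auto simp: L_def dest!: bound)
  then have "card ((+) c ` L j \<union> (+) (- c) ` L j) = 2 * card (L j)"
    by (subst card_Un_disjoint) (auto simp: L_def card_image)
  ultimately show ?case
    using Suc by (simp add: L_def)
qed

section \<open>The extremal sequence and its difference triangle\<close>

text \<open>The last term is 2 below the value \<open>2 ^ (n - 1) + 1\<close> that would continue
  the pattern.\<close>

definition witness :: "nat \<Rightarrow> int list" where
  "witness n = map (\<lambda>i. 2 ^ i + 1) [0..<n - 1] @ [2 ^ (n - 1) - 1]"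

lemma length_witness: "n \<ge> 1 \<Longrightarrow> length (witness n) = n"
  by (simp add: witness_def)

text \<open>The condition \<open>a + b < n\<close> keeps away from the last term. There the first
  row consists of powers of 2, and taking differences reproduces them.\<close>

lemma triangle_witness:
  assumes "1 \<le> b" "1 \<le> a" "a + b < n"
  shows "triangle (witness n) b a = 2 ^ (a - 1)"
  using assms
proof (induction b arbitrary: a rule: dec_induct)
  case base
  then obtain c where "a = Suc c" "Suc c < n - 1" by (cases a) auto
  then show ?case
    by (simp add: witness_def nth_append)
next
  case (step b)
  then obtain c where "a = Suc c" by (cases a) auto
  then show ?case
    using step by simp
qed

text \<open>The deficit 2 of the last term is passed down the anti-diagonal for as long as the
  entries stay nonnegative before taking absolute values.\<close>

lemma antidiagonal_witness:
  assumes "1 \<le> b" "b + 2 \<le> n"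
  shows "triangle (witness n) b (n - b) = 2 ^ (n - 1 - b) - 2"
  using assms
proof (induction b rule: dec_induct)
  case base
  then obtain m where "n = Suc (Suc (Suc m))"
    by (metis One_nat_def add_2_eq_Suc' Suc_le_D Suc_le_mono)
  then show ?case
    by (simp add: witness_def nth_append)
next
  case (step b)
  then obtain m where m: "n = b + 3 + m"
    using le_Suc_ex[of "b + 3" n] by auto
  have "triangle (witness n) b (Suc (Suc m)) = 2 ^ Suc m"
    using triangle_witness[of b "Suc (Suc m)" n] step m by simp
  then show ?case
    using step.IH step.hyps m by (simp add: numeral_3_eq_3)
qed

lemma antidiagonal_witness_last:
  assumes "n \<ge> 3"
  shows "triangle (witness n) (n - 1) 1 = 1"
proof -
  obtain m where m: "n = m + 3"
    using assms le_Suc_ex[of 3 n] by (auto simp: add.commute)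
  show ?thesis
    \<comment> \<open>Row \<open>n - 2\<close> is (1, 0), so the bottom entry is 1.\<close>
    using antidiagonal_witness[of "m + 1" n] triangle_witness[of "m + 1" 1 n]
      triangle.simps(2)[of "witness n" "m + 1" 1]
    by (simp add: m numeral_2_eq_2 del: triangle.simps)
qed

lemma gilbreath_witness:
  assumes "n \<ge> 3"
  shows "gilbreath (witness n)"
  unfolding gilbreath_def
proof
  fix b assume "b \<in> {1..length (witness n) - 1}"
  then have "1 \<le> b" "b < n - 1 \<or> b = n - 1"
    using assms by (auto simp: length_witness)
  then show "triangle (witness n) b 1 = 1"
    using triangle_witness[of b 1 n] antidiagonal_witness_last[OF assms] by auto
qed

lemma witness_in_gilbreath_seqs:
  assumes "n \<ge> 4"
  shows "witness n \<in> gilbreath_seqs n"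
proof -
  obtain m where m: "n = m + 4"
    using assms le_Suc_ex[of 4 n] by (auto simp: add.commute)
  have "(2::int) ^ i + 1 < 2 ^ (m + 3) - 1" if "i < m + 3" for i
  proof -
    have "(2::int) ^ i \<le> 2 ^ (m + 2)"
      using that by (intro power_increasing) auto
    \<comment> \<open>The final increment is \<open>2 ^ (m + 2) - 2\<close>; it is positive because
      \<open>n \<ge> 4\<close>.\<close>
    moreover have "(2::int) ^ 2 \<le> 2 ^ (m + 2)"
      by (intro power_increasing) auto
    then have "(2::int) ^ (m + 2) > 2"
      unfolding power2_eq_square by linarith
    moreover have "(2::int) ^ (m + 3) = 2 * 2 ^ (m + 2)"
      by (simp add: power_add)
    ultimately show ?thesis by linarith
  qed
  moreover have "sorted_wrt (<) (map (\<lambda>i. (2::int) ^ i + 1) [0..<m + 3])"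
    by (simp add: sorted_wrt_iff_nth_less add1_zle_eq del: upt_Suc)
  ultimately have "sorted_wrt (<) (witness n)"
    by (auto simp: witness_def sorted_wrt_append m add.commute simp del: upt_Suc)
  then show ?thesis
    using assms gilbreath_witness[of n]
    by (auto simp: gilbreath_seqs_def length_witness witness_def nth_append)
qed

lemma antidiagonal_sum_witness:
  assumes "n \<ge> 3"
  shows "antidiagonal_sum (witness n) = 2 ^ (n - 1) - 2 * int n + 3"
proof -
  obtain m where m: "n = m + 3"
    using assms le_Suc_ex[of 3 n] by (auto simp: add.commute)
  have geometric: "(\<Sum>i = 1..l. (2::int) ^ (l - i + 1) - 2) = 2 ^ (l + 1) - 2 * int l - 2" for l
  proof (induction l)
    case (Suc l)
    have "(\<Sum>i = 1..Suc l. (2::int) ^ (Suc l - i + 1) - 2) =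
        (2 ^ (l + 1) - 2) + (\<Sum>i = 1..l. (2::int) ^ (l - i + 1) - 2)"
      by (subst sum.atLeast_Suc_atMost)
        (auto simp: sum.atLeast_Suc_atMost_Suc_shift simp del: sum.cl_ivl_Suc power_Suc)
    then show ?case
      using Suc by simp
  qed simp
  have len: "length (witness (m + 3)) = m + 3"
    by (simp add: length_witness)
  have "antidiagonal_sum (witness n) =
      (\<Sum>i = 1..m + 1. antidiagonal (witness n) i) + antidiagonal (witness n) (m + 2)"
    by (simp add: antidiagonal_sum_def len m)
  also have "antidiagonal (witness n) (m + 2) = 1"
    using antidiagonal_witness_last[OF assms] by (simp add: antidiagonal_def len m)
  also have "(\<Sum>i = 1..m + 1. antidiagonal (witness n) i)
      = (\<Sum>i = 1..m + 1. (2::int) ^ (m + 1 - i + 1) - 2)"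
  proof (rule sum.cong)
    fix i assume "i \<in> {1..m + 1}"
    then show "antidiagonal (witness n) i = 2 ^ (m + 1 - i + 1) - 2"
      using antidiagonal_witness[of i n] by (simp add: antidiagonal_def len m Suc_diff_le)
  qed simp
  also have "\<dots> = 2 ^ (m + 2) - 2 * int (m + 1) - 2"
    using geometric[of "m + 1"] by simp
  finally show ?thesis
    by (simp add: m)
qed

section \<open>Valid extensions of the witness and the two bounds\<close>

lemma extensions_witness:
  assumes "n \<ge> 4"
  shows "extensions (witness n) = (+) (last (witness n)) ` offsets (n - 4)"
proof -
  have len: "length (witness n) = n"
    using assms by (simp add: length_witness)
  have "gilbreath (witness n @ [k]) \<longleftrightarrow> k - last (witness n) \<in> offsets (n - 4)" for k
  proof -
    let ?T = "witness n @ [k]"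
    define d where "d i = triangle ?T i (n + 1 - i)" for i
    have step: "d (Suc i) = \<bar>d i - triangle (witness n) i (n - i)\<bar>" if "i < n" for i
      using that by (simp add: d_def triangle_append len Suc_diff_le)
    have d1: "d 1 = \<bar>k - last (witness n)\<bar>"
      using step[of 0] assms len
      by (simp add: d_def nth_append last_conv_nth flip: length_greater_0_conv)
    have step': "d (Suc i) = \<bar>d i - (2 ^ (n - 1 - i) - 2)\<bar>" if "1 \<le> i" "i + 2 \<le> n" for i
      using step[of i] antidiagonal_witness[OF that] that by simp
    have nonneg: "d (Suc i) \<ge> 0" if "i < n" for i
      using step[OF that] by simp
    \<comment> \<open>Passing from \<open>d (Suc i)\<close> to \<open>d (Suc (Suc i))\<close>
      subtracts exactly the shift of the outermost layer of \<open>offsets\<close>, so each step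
      peels off one layer.\<close>
    have descend: "d 1 \<in> offsets (n - 4) \<longleftrightarrow> d (Suc i) \<in> offsets (n - 4 - i)" if "i \<le> n - 4" for i
      using that
    proof (induction i)
      case (Suc i)
      define j where "j = n - 4 - Suc i"
      have j: "n - 4 - i = Suc j" "n - Suc (Suc i) = j + 3"
        using Suc.prems unfolding j_def by auto
      have "d (Suc i) \<in> offsets (Suc j) \<longleftrightarrow> d (Suc (Suc i)) \<in> offsets j"
        using offsets_Suc_nonneg_iff[OF nonneg[of i], of j] step'[of "Suc i"] Suc.prems
        by (simp add: j)
      moreover have "d 1 \<in> offsets (n - 4) \<longleftrightarrow> d (Suc i) \<in> offsets (Suc j)"
        using Suc.IH Suc.prems unfolding j(1) by simp
      ultimately show ?case
        unfolding j_def[symmetric] by blast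
    qed simp
    obtain m where m: "n = m + 4"
      using assms le_Suc_ex[of 4 n] by (auto simp: add.commute)
    \<comment> \<open>The last anti-diagonal entries are 2, 0, 1. For
      \<open>d (m + 1) \<ge> 0\<close> the result is 1 iff \<open>d (m + 1)\<close> is 0, 2 or 4,
      the nonnegative half of the base block.\<close>
    have tail: "d (m + 1) \<in> offsets 0 \<longleftrightarrow> d n = 1"
    proof -
      have "d (m + 2) = \<bar>d (m + 1) - 2\<bar>" "d (m + 3) = \<bar>d (m + 2)\<bar>"
        using step'[of "m + 1"] step'[of "m + 2"] by (simp_all add: m numeral_3_eq_3)
      moreover have "d (m + 4) = \<bar>d (m + 3) - 1\<bar>"
        using step[of "m + 3"] antidiagonal_witness_last[of n] by (simp add: m add.commute)
      ultimately show ?thesis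
        using nonneg[of m] by (auto simp: m)
    qed
    have "gilbreath ?T \<longleftrightarrow> (\<forall>b \<in> {1..n}. triangle ?T b 1 = 1)"
      by (simp add: gilbreath_def len)
    \<comment> \<open>Only row \<open>n\<close> of the first column involves \<open>k\<close>; the
      earlier rows belong to the witness, which is Gilbreath.\<close>
    also have "\<dots> \<longleftrightarrow> triangle ?T n 1 = 1"
    proof -
      have "triangle ?T b 1 = 1" if "1 \<le> b" "b < n" for b
        using gilbreath_witness[of n] that assms
        by (simp add: gilbreath_def len triangle_append)
      then show ?thesis
        using assms by (metis One_nat_def Suc_leI atLeastAtMost_iff le_neq_implies_less less_le_trans
            order.refl zero_less_numeral)
    qed
    also have "\<dots> \<longleftrightarrow> d n = 1"
      by (simp add: d_def)
    also have "\<dots> \<longleftrightarrow> d 1 \<in> offsets (n - 4)"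
      using tail descend[of m] by (simp add: m)
    finally show ?thesis
      by (simp only: d1 abs_offsets_iff)
  qed
  then show ?thesis
    by (force simp: extensions_def image_iff)
qed

lemma num_components_witness:
  assumes "n \<ge> 4"
  shows "num_components (extensions (witness n)) \<ge> 2 ^ (n - 4)"
proof -
  let ?U = "offsets (n - 4)"
  let ?K = "(+) (last (witness n)) ` ?U"
  have "2 ^ (n - 4) \<le> card ((+) (last (witness n)) ` {u \<in> ?U. u - 2 \<notin> ?U})"
    using card_left_ends_offsets_ge[of "n - 4"] by (simp add: card_image)
  also have "(+) (last (witness n)) ` {u \<in> ?U. u - 2 \<notin> ?U} = {x \<in> ?K. x - 2 \<notin> ?K}"
    by (force simp: image_iff)
  also have "card \<dots> \<le> num_components ?K"
    by (rule card_left_ends_le_num_components) simp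
  finally show ?thesis
    by (simp add: extensions_witness[OF assms])
qed

lemma defect_witness:
  assumes "n \<ge> 4"
  shows "int (defect (witness n)) \<ge> 3 * 2 ^ (n - 4) - 2 * int n + 5"
proof -
  let ?s = "last (witness n)"
  obtain m where m: "n = m + 4"
    using assms le_Suc_ex[of 4 n] by (auto simp: add.commute)
  \<comment> \<open>The candidates are s + 2i with \<bar>i\<bar> \<le> q, where s is the last term.
    There are 2q + 1 = \<open>2 ^ (m + 3) - 2 * m - 3\<close> of them, and removing at most
    \<open>5 * 2 ^ m\<close> extensions gives the claim.\<close>
  define q where "q = 2 ^ (m + 2) - int m - 2"
  have A: "antidiagonal_sum (witness n) + 1 = 2 * q"
    using antidiagonal_sum_witness[of n] by (simp add: m q_def power_add)
  have fin: "finite (candidates (witness n))"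
    by (rule finite_subset[of _ "{?s - 2 * q..?s + 2 * q}"]) (auto simp: candidates_def A)
  have "(\<lambda>i. ?s + 2 * i) ` {-q..q} \<subseteq> candidates (witness n)"
    by (auto simp: candidates_def A cong_def)
  then have "card ((\<lambda>i. ?s + 2 * i) ` {-q..q}) \<le> card (candidates (witness n))"
    using fin by (rule card_mono[rotated])
  then have "2 * q + 1 \<le> int (card (candidates (witness n)))"
    by (simp add: card_image inj_on_def)
  moreover have "card (extensions (witness n)) \<le> 5 * 2 ^ m"
    using card_offsets_le[of m] extensions_witness[OF assms] by (simp add: card_image m)
  then have "int (card (extensions (witness n))) \<le> int (5 * 2 ^ m)"
    by (simp only: of_nat_le_iff)
  moreover have "card (candidates (witness n)) - card (extensions (witness n))
      \<le> defect (witness n)"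
    unfolding defect_def holes_def
    by (rule diff_card_le_card_Diff) (simp add: extensions_witness[OF assms])
  ultimately show ?thesis
    by (simp add: q_def m)
qed

theorem corollary36:
  fixes n :: nat
  assumes "n \<ge> 5"
  shows "(MAX S \<in> gilbreath_seqs n. num_components (extensions S)) \<ge> 2 ^ (n - 4) \<and>
         int (MAX S \<in> gilbreath_seqs n. defect S) \<ge> 3 * 2 ^ (n - 4) - 2 * int n + 5"
proof -
  have fin: "finite (gilbreath_seqs n)"
    using assms by (intro finite_gilbreath_seqs) simp
  have mem: "witness n \<in> gilbreath_seqs n"
    using assms by (intro witness_in_gilbreath_seqs) simp
  have "num_components (extensions (witness n))
      \<le> (MAX S \<in> gilbreath_seqs n. num_components (extensions S))"
    using fin mem by (intro Max_ge) auto
  moreover have "defect (witness n) \<le> (MAX S \<in> gilbreath_seqs n. defect S)"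
    using fin mem by (intro Max_ge) auto
  ultimately show ?thesis
    using num_components_witness[of n] defect_witness[of n] assms by linarith
qed

end
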